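(* Let $G$ be a second countable locally compact group and $H$ a closed subgroup of $G$. The following conditions are equivalent: (i) $H$ is open and there exists a proper $G$-invariant compatible metric $d$ on $G/H$; (ii) $H$ is the stabilizer of some point for a continuous action of $G$ by isometries on a locally finite (discrete) metric space; (iii) $H$ is an open almost normal subgroup of $G$.
   Context: All topological spaces and topological groups are Hausdorff. For a closed subgroup $H$ of a topological group $G$, the coset space $G/H=\{gH : g\in G\}$ carries the quotient topology, and $G$ acts on it by left translation. A compatible metric on a topological space is a metric inducing its topology. A metric $d$ on $G/H$ is $G$-invariant if $d(gx,gy)=d(x,y)$ for all $g\in G$ and $x,y\in G/H$. A metric is proper if all its closed balls $\{y : d(x,y)\le r\}$ are compact. A metric space is discrete if its metric induces the discrete topology; it is locally finite if it is both proper and discrete (so its closed balls are finite). A closed subgroup $H$ of a locally compact group $G$ is almost normal in $G$ if for every finite subset $K$ of $G$ there exists a finite subset $K'$ of $G$ such that $HK\subset K'H$ (equivalently, the orbits of $H$ acting on $G/H$ are finite). *)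

theory Defs
  imports
    "HOL-Analysis.Analysis"
    "HOL-Algebra.Left_Coset"
    "HOL-Algebra.Group_Action"
begin

locale topological_group = group G for G (structure) +
  fixes T :: "'a topology"
  assumes topspace_eq: "topspace T = carrier G"
    and Hausdorff: "Hausdorff_space T"
    and continuous_mult:
      "continuous_map (prod_topology T T) T (\<lambda>(x, y). x \<otimes> y)"
    and continuous_inv: "continuous_map T T (\<lambda>x. inv x)"

text \<open>The quotient topology on \<open>G/H\<close>, the finest one making \<open>g \<mapsto> gH\<close> continuous.\<close>

definition coset_topology ::
    "('a, 'c) monoid_scheme \<Rightarrow> 'a topology \<Rightarrow> 'a set \<Rightarrow> 'a set topology" where
  "coset_topology G T H =
     topology (\<lambda>U. U \<subseteq> lcosets\<^bsub>G\<^esub> H \<and> openin T {g \<in> topspace T. g <#\<^bsub>G\<^esub> H \<in> U})"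

lemma openin_coset_topology:
  "openin (coset_topology G T H) U \<longleftrightarrow>
     U \<subseteq> lcosets\<^bsub>G\<^esub> H \<and> openin T {g \<in> topspace T. g <#\<^bsub>G\<^esub> H \<in> U}"
proof -
  let ?pre = "\<lambda>U. {g \<in> topspace T. g <#\<^bsub>G\<^esub> H \<in> U}"
  have "istopology (\<lambda>U. U \<subseteq> lcosets\<^bsub>G\<^esub> H \<and> openin T (?pre U))"
    unfolding istopology_def
  proof (intro conjI allI impI)
    fix S U
    assume "S \<subseteq> lcosets\<^bsub>G\<^esub> H \<and> openin T (?pre S)" "U \<subseteq> lcosets\<^bsub>G\<^esub> H \<and> openin T (?pre U)"
    moreover have "?pre (S \<inter> U) = ?pre S \<inter> ?pre U" by blast
    ultimately show "S \<inter> U \<subseteq> lcosets\<^bsub>G\<^esub> H" "openin T (?pre (S \<inter> U))"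
      by auto
  next
    fix \<K>
    assume *: "\<forall>K\<in>\<K>. K \<subseteq> lcosets\<^bsub>G\<^esub> H \<and> openin T (?pre K)"
    have "?pre (\<Union>\<K>) = \<Union>(?pre ` \<K>)" by blast
    with * show "openin T (?pre (\<Union>\<K>))" by auto
    show "\<Union>\<K> \<subseteq> lcosets\<^bsub>G\<^esub> H" using * by blast
  qed
  then show ?thesis
    by (simp add: coset_topology_def topology_inverse')
qed

definition proper_metric :: "'m set \<Rightarrow> ('m \<Rightarrow> 'm \<Rightarrow> real) \<Rightarrow> bool" where
  "proper_metric M d \<longleftrightarrow>
     (\<forall>x\<in>M. \<forall>r. compactin (Metric_space.mtopology M d) (Metric_space.mcball M d x r))"

definition locally_finite_metric :: "'m set \<Rightarrow> ('m \<Rightarrow> 'm \<Rightarrow> real) \<Rightarrow> bool" where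
  "locally_finite_metric M d \<longleftrightarrow>
     proper_metric M d \<and> Metric_space.mtopology M d = discrete_topology M"

definition invariant_coset_metric ::
    "('a, 'c) monoid_scheme \<Rightarrow> 'a set \<Rightarrow> ('a set \<Rightarrow> 'a set \<Rightarrow> real) \<Rightarrow> bool" where
  "invariant_coset_metric G H d \<longleftrightarrow>
     (\<forall>g\<in>carrier G. \<forall>x\<in>lcosets\<^bsub>G\<^esub> H. \<forall>y\<in>lcosets\<^bsub>G\<^esub> H.
        d (g <#\<^bsub>G\<^esub> x) (g <#\<^bsub>G\<^esub> y) = d x y)"

definition continuous_isometric_action ::
    "('a, 'c) monoid_scheme \<Rightarrow> 'a topology \<Rightarrow> 'm set \<Rightarrow> ('m \<Rightarrow> 'm \<Rightarrow> real)
      \<Rightarrow> ('a \<Rightarrow> 'm \<Rightarrow> 'm) \<Rightarrow> bool" where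
  "continuous_isometric_action G T M d \<phi> \<longleftrightarrow>
     group_action G M \<phi> \<and>
     (\<forall>g\<in>carrier G. \<forall>x\<in>M. \<forall>y\<in>M. d (\<phi> g x) (\<phi> g y) = d x y) \<and>
     continuous_map (prod_topology T (Metric_space.mtopology M d))
       (Metric_space.mtopology M d) (\<lambda>(g, x). \<phi> g x)"

text \<open>HOL cannot quantify over types inside a formula, so the type of which the
  metric space is a subset is passed as the first argument.\<close>

definition stabilizer_in_locally_finite_space ::
    "'m itself \<Rightarrow> ('a, 'c) monoid_scheme \<Rightarrow> 'a topology \<Rightarrow> 'a set \<Rightarrow> bool" where
  "stabilizer_in_locally_finite_space _ G T H \<longleftrightarrow>
     (\<exists>(M :: 'm set) d \<phi>. Metric_space M d \<and> locally_finite_metric M d \<and>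
        continuous_isometric_action G T M d \<phi> \<and> (\<exists>x\<in>M. stabilizer G \<phi> x = H))"

definition almost_normal :: "('a, 'c) monoid_scheme \<Rightarrow> 'a set \<Rightarrow> bool" where
  "almost_normal G H \<longleftrightarrow>
     (\<forall>K. finite K \<and> K \<subseteq> carrier G \<longrightarrow>
        (\<exists>K'. finite K' \<and> K' \<subseteq> carrier G \<and> H <#>\<^bsub>G\<^esub> K \<subseteq> K' <#>\<^bsub>G\<^esub> H))"

end

theory Submission
  imports Defs
begin

text \<open>
  Openness of \<open>H\<close> makes \<open>G/H\<close> discrete, and the remaining part of each condition then says in
  its own way that \<open>H\<close> moves every point of \<open>G/H\<close> through finitely many places only.

  A proper invariant metric \<open>d\<close> on a discrete \<open>G/H\<close> is locally finite, left multiplication is a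
  continuous isometric action for it, and the stabilizer of the point \<open>H\<close> is \<open>H\<close>
  (\<open>proper_coset_metric_imp_stabilizer\<close>). If conversely \<open>H\<close> is the stabilizer of \<open>x\<close> in a
  locally finite space, then \<open>H\<close> is the preimage of the open set \<open>{x}\<close> under the orbit map,
  hence open; and the \<open>H\<close>-orbit of \<open>y\<close> stays in the closed ball about \<open>x\<close> of radius \<open>d x y\<close>,
  hence is finite, which is almost normality (\<open>stabilizer_imp_open_almost_normal\<close>).

  The substance is the construction of a metric from almost normality. It rests on a fact about
  arbitrary actions: a countable set on which all point stabilizers have finite orbits carries an
  invariant locally finite metric (\<open>invariant_locally_finite_metric\<close>). Call a relation locally
  finite if each point is related to finitely many others. The hypothesis on the stabilizers says
  that every orbit of \<open>G\<close> on pairs of points is a locally finite relation. List these orbits,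
  symmetrized, as \<open>R 0, R 1, \<dots>\<close>, let \<open>S 0\<close> be equality, and let \<open>S (n + 1)\<close> be the union of
  \<open>S n O S n\<close> and \<open>R n\<close>. Each \<open>S n\<close> is invariant, symmetric and locally finite, the \<open>S n\<close>
  increase, and together they relate any two points. Hence \<open>d x y = (LEAST n. (x, y) \<in> S n)\<close>
  is defined, and its balls are finite. By construction
  \<open>d x z \<le> max (d x y) (d y z) + 1\<close>; since distinct points have distance at least \<open>1\<close>, this
  already implies the triangle inequality. The set \<open>G/H\<close> is countable because it is a discrete
  open image of the second countable space \<open>G\<close>.
\<close>

section \<open>Integer metrics from sequences of locally finite relations\<close>

primrec reach :: "'m set \<Rightarrow> (nat \<Rightarrow> ('m \<times> 'm) set) \<Rightarrow> nat \<Rightarrow> ('m \<times> 'm) set" where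
  "reach M R 0 = Id_on M"
| "reach M R (Suc n) = (reach M R n O reach M R n) \<union> R n"

definition reach_dist :: "'m set \<Rightarrow> (nat \<Rightarrow> ('m \<times> 'm) set) \<Rightarrow> 'm \<Rightarrow> 'm \<Rightarrow> nat" where
  "reach_dist M R x y = (LEAST n. (x, y) \<in> reach M R n)"

text \<open>This is how invariance of the relations \<open>R n\<close> under a group passes to the metric.\<close>

lemma reach_equivariant:
  assumes "f ` M \<subseteq> M" and "\<And>n x y. (x, y) \<in> R n \<Longrightarrow> (f x, f y) \<in> R n"
    and "(x, y) \<in> reach M R n"
  shows "(f x, f y) \<in> reach M R n"
  using assms(3)
proof (induction n arbitrary: x y)
  case 0
  then show ?case using assms(1) by auto
next
  case (Suc n)
  then show ?case using assms(2) by (auto intro: relcompI)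
qed

text \<open>The finiteness condition speaks of sections at a point rather than of the relations \<open>R n\<close>
  themselves, because composition preserves it.\<close>

locale locally_finite_cover =
  fixes M :: "'m set" and R :: "nat \<Rightarrow> ('m \<times> 'm) set"
  assumes R_subset: "R n \<subseteq> M \<times> M"
    and R_sym: "sym (R n)"
    and R_finite: "finite (R n `` {x})"
    and R_cover: "M \<times> M \<subseteq> (\<Union>n. R n)"
begin

lemma reach_subset: "reach M R n \<subseteq> M \<times> M"
proof (induction n)
  case (Suc n)
  then show ?case using R_subset[of n] by auto
qed auto

lemma reach_refl: "x \<in> M \<Longrightarrow> (x, x) \<in> reach M R n"
  by (induction n) auto

lemma reach_mono: "m \<le> n \<Longrightarrow> reach M R m \<subseteq> reach M R n"
proof (induction n rule: dec_induct)
  case (step n)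
  have "reach M R n \<subseteq> reach M R (Suc n)"
    using reach_refl reach_subset[of n] by fastforce
  with step.IH show ?case by blast
qed simp

lemma reach_sym: "(x, y) \<in> reach M R n \<Longrightarrow> (y, x) \<in> reach M R n"
proof (induction n arbitrary: x y)
  case (Suc n)
  then show ?case using R_sym[of n] by (auto dest: symD)
qed auto

lemma reach_finite: "finite (reach M R n `` {x})"
proof (induction n arbitrary: x)
  case 0
  then show ?case by (rule finite_subset[of _ "{x}"]) auto
next
  case (Suc n)
  have "reach M R (Suc n) `` {x} =
      (\<Union>y \<in> reach M R n `` {x}. reach M R n `` {y}) \<union> R n `` {x}"
    by auto
  with Suc R_finite show ?case by simp
qed

lemma reach_cover:
  assumes "x \<in> M" "y \<in> M"
  shows "\<exists>n. (x, y) \<in> reach M R n"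
proof -
  obtain n where "(x, y) \<in> R n" using R_cover assms by blast
  then have "(x, y) \<in> reach M R (Suc n)" by simp
  then show ?thesis ..
qed

text \<open>Closed balls are exactly the sections of the relations \<open>reach M R n\<close>, so every property of
  the metric can be read off from these relations.\<close>

lemma reach_dist_le_iff:
  assumes "x \<in> M" "y \<in> M"
  shows "reach_dist M R x y \<le> n \<longleftrightarrow> (x, y) \<in> reach M R n"
proof
  have "(x, y) \<in> reach M R (reach_dist M R x y)"
    unfolding reach_dist_def using reach_cover[OF assms] by (auto intro: LeastI)
  then show "(x, y) \<in> reach M R n" if "reach_dist M R x y \<le> n"
    using reach_mono[OF that] by blast
  show "reach_dist M R x y \<le> n" if "(x, y) \<in> reach M R n"
    unfolding reach_dist_def using that by (rule Least_le)
qed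

lemma reach_dist_commute: "reach_dist M R x y = reach_dist M R y x"
  unfolding reach_dist_def by (metis reach_sym)

lemma reach_dist_zero:
  "x \<in> M \<Longrightarrow> y \<in> M \<Longrightarrow> reach_dist M R x y = 0 \<longleftrightarrow> x = y"
  using reach_dist_le_iff[of x y 0] by auto

text \<open>With \<open>m\<close> the larger of the two distances on the right, one composition gives
  \<open>reach_dist M R x z \<le> m + 1\<close>. If \<open>y\<close> differs from \<open>x\<close> and from \<open>z\<close>, the smaller
  distance is at least \<open>1\<close> and absorbs the additional \<open>1\<close>.\<close>

lemma reach_dist_triangle:
  assumes "x \<in> M" "y \<in> M" "z \<in> M"
  shows "reach_dist M R x z \<le> reach_dist M R x y + reach_dist M R y z"
proof (cases "x = y \<or> y = z")
  case True
  then show ?thesis by auto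
next
  case False
  let ?m = "max (reach_dist M R x y) (reach_dist M R y z)"
  have "(x, y) \<in> reach M R ?m" "(y, z) \<in> reach M R ?m"
    using assms by (simp_all flip: reach_dist_le_iff)
  then have "(x, z) \<in> reach M R (Suc ?m)" by auto
  then have "reach_dist M R x z \<le> Suc ?m"
    using assms by (simp add: reach_dist_le_iff del: reach.simps)
  moreover have "reach_dist M R x y \<noteq> 0" "reach_dist M R y z \<noteq> 0"
    using False assms by (simp_all add: reach_dist_zero)
  ultimately show ?thesis by linarith
qed

lemma Metric_space_reach_dist: "Metric_space M (\<lambda>x y. real (reach_dist M R x y))"
proof
  show "real (reach_dist M R x z) \<le> real (reach_dist M R x y) + real (reach_dist M R y z)"
    if "x \<in> M" "y \<in> M" "z \<in> M" for x y z
    using reach_dist_triangle[OF that] by linarith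
qed (auto simp: reach_dist_zero intro: reach_dist_commute)

lemma locally_finite_reach_dist: "locally_finite_metric M (\<lambda>x y. real (reach_dist M R x y))"
proof -
  interpret Metric_space M "\<lambda>x y. real (reach_dist M R x y)"
    by (rule Metric_space_reach_dist)
  have "openin mtopology {x}" if "x \<in> M" for x
  proof -
    have "mball x 1 = {x}" using that by (auto simp: reach_dist_zero)
    then show ?thesis using openin_mball[of x 1] by simp
  qed
  then have discrete: "mtopology = discrete_topology M"
    by (metis discrete_topology_unique topspace_mtopology)
  have "finite (mcball x r)" for x r
  proof (rule finite_subset)
    show "mcball x r \<subseteq> reach M R (nat \<lfloor>r\<rfloor>) `` {x}"
      by (auto simp flip: reach_dist_le_iff simp: le_nat_floor)
  qed (rule reach_finite)
  then show ?thesis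
    by (simp add: locally_finite_metric_def proper_metric_def discrete
        compactin_discrete_topology mcball_subset_mspace)
qed

end


section \<open>Invariant metrics for actions with finite stabilizer orbits\<close>

definition diagonal_orbit ::
    "('a, 'c) monoid_scheme \<Rightarrow> ('a \<Rightarrow> 'm \<Rightarrow> 'm) \<Rightarrow> 'm \<times> 'm \<Rightarrow> ('m \<times> 'm) set" where
  "diagonal_orbit G \<phi> p = (\<lambda>g. (\<phi> g (fst p), \<phi> g (snd p))) ` carrier G"

context group_action
begin

lemma is_group: "group G"
  using group_hom group_hom.axioms(1) by blast

lemma diagonal_orbit_self:
  assumes "x \<in> E" "y \<in> E"
  shows "(x, y) \<in> diagonal_orbit G \<phi> (x, y)"
proof -
  have "\<phi> \<one> x = x" "\<phi> \<one> y = y" using assms by (simp_all flip: id_eq_one)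
  then show ?thesis
    unfolding diagonal_orbit_def using group.is_monoid[OF is_group]
    by (intro image_eqI[of _ _ \<one>]) (auto simp: monoid.one_closed)
qed

lemma diagonal_orbit_subset:
  "p \<in> E \<times> E \<Longrightarrow> diagonal_orbit G \<phi> p \<subseteq> E \<times> E"
  unfolding diagonal_orbit_def by (auto intro: element_image)

lemma diagonal_orbit_invariant:
  assumes "p \<in> E \<times> E" "g \<in> carrier G" "(x, y) \<in> diagonal_orbit G \<phi> p"
  shows "(\<phi> g x, \<phi> g y) \<in> diagonal_orbit G \<phi> p"
proof -
  interpret group G by (rule is_group)
  obtain h where h: "h \<in> carrier G" "x = \<phi> h (fst p)" "y = \<phi> h (snd p)"
    using assms(3) unfolding diagonal_orbit_def by auto
  then have "\<phi> g x = \<phi> (g \<otimes> h) (fst p)" "\<phi> g y = \<phi> (g \<otimes> h) (snd p)"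
    using assms by (auto simp: composition_rule mem_Times_iff)
  then show ?thesis unfolding diagonal_orbit_def using h assms(2) by auto
qed

text \<open>If \<open>g\<close> carries \<open>p\<close> to \<open>x\<close>, then so do exactly the elements of \<open>g\<close> times the stabilizer of
  \<open>p\<close>; the points paired with \<open>x\<close> thus form the translate by \<open>g\<close> of a stabilizer orbit.\<close>

lemma finite_diagonal_orbit_section:
  assumes p: "p \<in> E" and q: "q \<in> E"
    and fin: "finite ((\<lambda>g. \<phi> g q) ` stabilizer G \<phi> p)"
  shows "finite (diagonal_orbit G \<phi> (p, q) `` {x})"
proof (cases "\<exists>g\<in>carrier G. \<phi> g p = x")
  case False
  then have "diagonal_orbit G \<phi> (p, q) `` {x} = {}" by (auto simp: diagonal_orbit_def)
  then show ?thesis by simp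
next
  case True
  interpret group G by (rule is_group)
  obtain g where g: "g \<in> carrier G" "\<phi> g p = x" using True by blast
  have "diagonal_orbit G \<phi> (p, q) `` {x} \<subseteq> \<phi> g ` (\<lambda>g. \<phi> g q) ` stabilizer G \<phi> p"
  proof
    fix y assume "y \<in> diagonal_orbit G \<phi> (p, q) `` {x}"
    then obtain h where h: "h \<in> carrier G" "\<phi> h p = x" "y = \<phi> h q"
      by (auto simp: diagonal_orbit_def)
    have "\<phi> (inv g \<otimes> h) p = p"
      using g h p by (simp add: composition_rule orbit_sym_aux)
    then have "inv g \<otimes> h \<in> stabilizer G \<phi> p"
      using g h by (simp add: stabilizer_def)
    moreover have "\<phi> g (\<phi> (inv g \<otimes> h) q) = \<phi> h q"
      using g h q by (simp flip: composition_rule add: m_assoc[symmetric])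
    ultimately show "y \<in> \<phi> g ` (\<lambda>g. \<phi> g q) ` stabilizer G \<phi> p"
      using h(3) by (metis imageI)
  qed
  then show ?thesis using fin by (meson finite_imageI finite_subset)
qed

text \<open>The diagonal orbits are fed one by one into the construction of the previous section. An orbit
  need not be symmetric, but the converse of the orbit of \<open>(a, b)\<close> is the orbit of \<open>(b, a)\<close>, so
  symmetrizing keeps the sections finite.\<close>

theorem invariant_locally_finite_metric:
  assumes "countable E"
    and fin: "\<And>p q. p \<in> E \<Longrightarrow> q \<in> E \<Longrightarrow> finite ((\<lambda>g. \<phi> g q) ` stabilizer G \<phi> p)"
  obtains d where "Metric_space E d" "locally_finite_metric E d"
    "\<And>g x y. g \<in> carrier G \<Longrightarrow> x \<in> E \<Longrightarrow> y \<in> E \<Longrightarrow> d (\<phi> g x) (\<phi> g y) = d x y"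
proof -
  interpret group G by (rule is_group)
  \<comment> \<open>\<open>s n\<close> is the \<open>n\<close>-th pair as a set, possibly empty, so that finite and empty \<open>E\<close> need no
    separate treatment.\<close>
  define s where "s n = {p \<in> E \<times> E. to_nat_on (E \<times> E) p = n}" for n
  have s_at_most_one: "p = q" if "p \<in> s n" "q \<in> s n" for p q n
    using that assms(1) by (auto simp: s_def)
  define R where "R n = (\<Union>p \<in> s n. diagonal_orbit G \<phi> p \<union> (diagonal_orbit G \<phi> p)\<inverse>)" for n
  interpret locally_finite_cover E R
  proof
    have "diagonal_orbit G \<phi> p \<union> (diagonal_orbit G \<phi> p)\<inverse> \<subseteq> E \<times> E" if "p \<in> s n" for p n
      using that diagonal_orbit_subset[of p] by (auto simp: s_def)
    then show "R n \<subseteq> E \<times> E" for n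
      unfolding R_def by blast
    show "sym (R n)" for n
      unfolding R_def sym_def by blast
    show "E \<times> E \<subseteq> (\<Union>n. R n)"
      unfolding R_def s_def using diagonal_orbit_self by auto
    fix n x
    have "finite (s n)"
    proof (cases "s n = {}")
      case False
      then obtain p where "p \<in> s n" by blast
      then have "s n \<subseteq> {p}" using s_at_most_one by blast
      then show ?thesis by (rule finite_subset) simp
    qed simp
    moreover have "finite ((diagonal_orbit G \<phi> p \<union> (diagonal_orbit G \<phi> p)\<inverse>) `` {x})"
      if "p \<in> s n" for p
    proof -
      obtain a b where p: "p = (a, b)" by fastforce
      with that have ab: "a \<in> E" "b \<in> E" by (auto simp: s_def)
      have "(diagonal_orbit G \<phi> (a, b))\<inverse> = diagonal_orbit G \<phi> (b, a)"
        by (auto simp: diagonal_orbit_def)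
      then show ?thesis
        unfolding p using ab fin by (simp add: Un_Image finite_diagonal_orbit_section)
    qed
    moreover have "R n `` {x} =
        (\<Union>p \<in> s n. (diagonal_orbit G \<phi> p \<union> (diagonal_orbit G \<phi> p)\<inverse>) `` {x})"
      unfolding R_def by blast
    ultimately show "finite (R n `` {x})" by simp
  qed
  have R_invariant: "(\<phi> g x, \<phi> g y) \<in> R n" if "(x, y) \<in> R n" "g \<in> carrier G" for g x y n
  proof -
    obtain p where p: "p \<in> s n" "(x, y) \<in> diagonal_orbit G \<phi> p \<or> (y, x) \<in> diagonal_orbit G \<phi> p"
      using \<open>(x, y) \<in> R n\<close> unfolding R_def by blast
    then have "p \<in> E \<times> E" by (simp add: s_def)
    with p show ?thesis
      using diagonal_orbit_invariant[OF _ \<open>g \<in> carrier G\<close>] unfolding R_def by blast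
  qed
  have reach_invariant: "(\<phi> g x, \<phi> g y) \<in> reach E R n"
    if "(x, y) \<in> reach E R n" "g \<in> carrier G" for g x y n
    using reach_equivariant[of "\<phi> g" E R] that R_invariant by (simp add: surj_prop)
  show thesis
  proof (rule that[OF Metric_space_reach_dist locally_finite_reach_dist])
    fix g x y assume g: "g \<in> carrier G" and xy: "x \<in> E" "y \<in> E"
    \<comment> \<open>The converse direction is the forward one for \<open>inv g\<close>.\<close>
    have "(\<phi> g x, \<phi> g y) \<in> reach E R n \<longleftrightarrow> (x, y) \<in> reach E R n" for n
      using reach_invariant[of "\<phi> g x" "\<phi> g y" n "inv g"] reach_invariant[of x y n g] g xy
      by (auto simp: orbit_sym_aux)
    then show "real (reach_dist E R (\<phi> g x) (\<phi> g y)) = real (reach_dist E R x y)"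
      by (simp add: reach_dist_def)
  qed
qed

end


section \<open>The action on left cosets\<close>

text \<open>The restriction to cosets is there because an action takes values in the extensional
  bijections of the set acted on.\<close>

abbreviation coset_action ::
    "('a, 'c) monoid_scheme \<Rightarrow> 'a set \<Rightarrow> 'a \<Rightarrow> 'a set \<Rightarrow> 'a set" where
  "coset_action G H g \<equiv> \<lambda>x \<in> lcosets\<^bsub>G\<^esub> H. g <#\<^bsub>G\<^esub> x"

context group
begin

lemma in_lcosets: "a \<in> carrier G \<Longrightarrow> a <# H \<in> lcosets H"
  by (auto simp: LCOSETS_def)

lemma subgroup_in_lcosets: "subgroup H G \<Longrightarrow> H \<in> lcosets H"
  using in_lcosets[OF one_closed, of H] by (simp add: lcos_mult_one subgroup.subset)

lemma lcosetsE:
  assumes "x \<in> lcosets H"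
  obtains a where "a \<in> carrier G" "x = a <# H"
  using assms by (auto simp: LCOSETS_def)

lemma l_coset_in_lcosets:
  assumes "subgroup H G" "g \<in> carrier G" "x \<in> lcosets H"
  shows "g <# x \<in> lcosets H"
proof -
  obtain a where "a \<in> carrier G" "x = a <# H" using assms(3) by (rule lcosetsE)
  then show ?thesis
    using assms by (auto simp: lcos_m_assoc subgroup.subset intro: in_lcosets)
qed

lemma l_coset_eq_iff:
  assumes "subgroup H G" "a \<in> carrier G" "b \<in> carrier G"
  shows "a <# H = b <# H \<longleftrightarrow> inv b \<otimes> a \<in> H"
proof
  assume "a <# H = b <# H"
  then have "a \<in> b <# H" using lcos_self assms by blast
  then show "inv b \<otimes> a \<in> H"
    using subgroup.lcos_module_imp[OF assms(1) is_group] assms by blast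
next
  assume "inv b \<otimes> a \<in> H"
  moreover have "a = b \<otimes> (inv b \<otimes> a)" using assms by (simp flip: m_assoc)
  ultimately have "a \<in> b <# H" unfolding l_coset_def by blast
  then show "a <# H = b <# H" using l_repr_independence assms by blast
qed

lemma coset_action_is_group_action:
  assumes H: "subgroup H G"
  shows "group_action G (lcosets H) (coset_action G H)"
proof -
  have sub: "x \<subseteq> carrier G" if "x \<in> lcosets H" for x
    using subgroup.lcosets_carrier[OF H is_group that] .
  have Bij: "coset_action G H g \<in> Bij (lcosets H)" if "g \<in> carrier G" for g
  proof -
    have "bij_betw (coset_action G H g) (lcosets H) (lcosets H)"
      by (rule bij_betw_byWitness[where f' = "coset_action G H (inv g)"])
        (use that H sub in \<open>auto simp: l_coset_in_lcosets lcos_m_assoc lcos_mult_one\<close>)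
    then show ?thesis by (simp add: Bij_def)
  qed
  have "coset_action G H (g \<otimes> h) = compose (lcosets H) (coset_action G H g) (coset_action G H h)"
    if "g \<in> carrier G" "h \<in> carrier G" for g h
    using that H sub by (auto simp: compose_def l_coset_in_lcosets lcos_m_assoc intro!: restrict_ext)
  then have "coset_action G H \<in> hom G (BijGroup (lcosets H))"
    using Bij by (simp add: hom_def BijGroup_def)
  then show ?thesis
    by (intro group_action.intro group_hom.intro group_hom_axioms.intro is_group group_BijGroup)
qed

lemma stabilizer_coset_action:
  assumes H: "subgroup H G" and "a \<in> carrier G"
  shows "stabilizer G (coset_action G H) (a <# H) = {g \<in> carrier G. inv a \<otimes> g \<otimes> a \<in> H}"
  unfolding stabilizer_def using assms
  by (intro Collect_cong)
    (simp add: in_lcosets lcos_m_assoc subgroup.subset l_coset_eq_iff m_assoc cong: conj_cong)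

text \<open>The stabilizer of \<open>aH\<close> is \<open>a H a\<inverse>\<close>, and its orbit of \<open>bH\<close> is the translate by \<open>a\<close> of
  the \<open>H\<close>-orbit of \<open>a\<inverse>bH\<close>. Almost normality for the single element \<open>a\<inverse>b\<close> bounds the latter.\<close>

lemma almost_normal_finite_stabilizer_orbits:
  assumes H: "subgroup H G" and an: "almost_normal G H"
    and p: "p \<in> lcosets H" and q: "q \<in> lcosets H"
  shows "finite ((\<lambda>g. coset_action G H g q) ` stabilizer G (coset_action G H) p)"
proof -
  obtain a where a: "a \<in> carrier G" "p = a <# H" using p by (rule lcosetsE)
  obtain b where b: "b \<in> carrier G" "q = b <# H" using q by (rule lcosetsE)
  obtain K' where K': "finite K'" "K' \<subseteq> carrier G" "H <#> {inv a \<otimes> b} \<subseteq> K' <#> H"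
    using an[unfolded almost_normal_def, rule_format, of "{inv a \<otimes> b}"] a b by auto
  have "(\<lambda>g. coset_action G H g q) ` stabilizer G (coset_action G H) p \<subseteq> (\<lambda>k. (a \<otimes> k) <# H) ` K'"
  proof clarify
    fix g assume "g \<in> stabilizer G (coset_action G H) p"
    then have g: "g \<in> carrier G" "inv a \<otimes> g \<otimes> a \<in> H"
      using a H by (auto simp: stabilizer_coset_action)
    have "a \<otimes> (inv a \<otimes> b) = b"
      using a b by (simp flip: m_assoc)
    then have r_cancel: "(inv a \<otimes> g \<otimes> a) \<otimes> (inv a \<otimes> b) = inv a \<otimes> (g \<otimes> b)"
      using a b g(1) by (simp add: m_assoc)
    have "(inv a \<otimes> g \<otimes> a) \<otimes> (inv a \<otimes> b) \<in> K' <#> H"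
      using K'(3) g(2) unfolding set_mult_def by blast
    then obtain k h where kh: "k \<in> K'" "h \<in> H" "inv a \<otimes> (g \<otimes> b) = k \<otimes> h"
      using a b g r_cancel by (auto simp: set_mult_def)
    have kh': "k \<in> carrier G" "h \<in> carrier G"
      using kh K' subgroup.subset[OF H] by auto
    have "inv (a \<otimes> k) \<otimes> (g \<otimes> b) = inv k \<otimes> (inv a \<otimes> (g \<otimes> b))"
      using a b g kh' by (simp add: inv_mult_group m_assoc)
    also have "\<dots> = h" using kh(3) kh' by (simp flip: m_assoc)
    finally have "(g \<otimes> b) <# H = (a \<otimes> k) <# H"
      using kh(2) a b g kh' H by (simp add: l_coset_eq_iff)
    then have "coset_action G H g q = (a \<otimes> k) <# H"
      using b g H q by (simp add: lcos_m_assoc subgroup.subset)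
    then show "coset_action G H g q \<in> (\<lambda>k. (a \<otimes> k) <# H) ` K'"
      using kh(1) by blast
  qed
  then show ?thesis using K'(1) by (meson finite_imageI finite_subset)
qed

end

text \<open>The set \<open>H K\<close> moves \<open>x\<close> into finitely many \<open>H\<close>-orbits, hence to finitely many points. One
  element of \<open>H K\<close> for each of these points suffices for \<open>K'\<close>: two elements that agree on
  \<open>x\<close> differ on the right by an element of \<open>H\<close>.\<close>

lemma (in group_action) almost_normal_stabilizer:
  assumes x: "x \<in> E"
    and fin: "\<And>y. y \<in> E \<Longrightarrow> finite ((\<lambda>h. \<phi> h y) ` stabilizer G \<phi> x)"
  shows "almost_normal G (stabilizer G \<phi> x)"
  unfolding almost_normal_def
proof (intro allI impI, elim conjE)
  interpret group G by (rule is_group)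
  let ?H = "stabilizer G \<phi> x"
  have H: "?H \<subseteq> carrier G" by (rule stabilizer_subset)
  fix K assume K: "finite K" "K \<subseteq> carrier G"
  have HK: "?H <#> K \<subseteq> carrier G" using set_mult_closed H K(2) by blast
  have "(\<lambda>g. \<phi> g x) ` (?H <#> K) \<subseteq> (\<Union>k\<in>K. (\<lambda>h. \<phi> h (\<phi> k x)) ` ?H)"
  proof clarify
    fix g assume "g \<in> ?H <#> K"
    then obtain h k where "h \<in> ?H" "k \<in> K" "g = h \<otimes> k" by (auto simp: set_mult_def)
    then show "\<phi> g x \<in> (\<Union>k\<in>K. (\<lambda>h. \<phi> h (\<phi> k x)) ` ?H)"
      using H K x by (auto simp: composition_rule subset_iff)
  qed
  moreover have "finite (\<Union>k\<in>K. (\<lambda>h. \<phi> h (\<phi> k x)) ` ?H)"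
    using K x fin element_image by blast
  ultimately have "finite ((\<lambda>g. \<phi> g x) ` (?H <#> K))" by (rule finite_subset)
  then obtain K' where K': "K' \<subseteq> ?H <#> K" "finite K'"
      "(\<lambda>g. \<phi> g x) ` (?H <#> K) = (\<lambda>g. \<phi> g x) ` K'"
    using finite_subset_image[OF _ subset_refl] by metis
  have "?H <#> K \<subseteq> K' <#> ?H"
  proof
    fix g assume g: "g \<in> ?H <#> K"
    then obtain k where k: "k \<in> K'" "\<phi> g x = \<phi> k x" using K'(3) by blast
    have carr: "g \<in> carrier G" "k \<in> carrier G" using g k K' HK by auto
    have "\<phi> (inv k \<otimes> g) x = x"
      using carr x k(2) by (simp add: composition_rule orbit_sym_aux)
    then have "inv k \<otimes> g \<in> ?H" using carr by (simp add: stabilizer_def)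
    moreover have "g = k \<otimes> (inv k \<otimes> g)" using carr by (simp flip: m_assoc)
    ultimately show "g \<in> K' <#> ?H" using k(1) unfolding set_mult_def by blast
  qed
  then show "\<exists>K'. finite K' \<and> K' \<subseteq> carrier G \<and> ?H <#> K \<subseteq> K' <#> ?H"
    using K' HK by blast
qed


section \<open>Open subgroups and discrete coset spaces\<close>

context topological_group
begin

lemma continuous_map_left_translation:
  assumes "a \<in> carrier G"
  shows "continuous_map T T (\<lambda>g. a \<otimes> g)"
proof -
  have "continuous_map T (prod_topology T T) (\<lambda>g. (a, g))"
    using assms by (simp add: continuous_map_pairwise o_def topspace_eq)
  from continuous_map_compose[OF this continuous_mult] show ?thesis by (simp add: o_def)
qed

lemma continuous_map_right_translation:
  assumes "a \<in> carrier G"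
  shows "continuous_map T T (\<lambda>g. g \<otimes> a)"
proof -
  have "continuous_map T (prod_topology T T) (\<lambda>g. (g, a))"
    using assms by (simp add: continuous_map_pairwise o_def topspace_eq)
  from continuous_map_compose[OF this continuous_mult] show ?thesis by (simp add: o_def)
qed

lemma openin_l_coset:
  assumes "a \<in> carrier G" "openin T U"
  shows "openin T (a <# U)"
proof -
  have U: "U \<subseteq> carrier G" using openin_subset[OF assms(2)] by (simp add: topspace_eq)
  have "a <# U = {g \<in> topspace T. inv a \<otimes> g \<in> U}"
  proof (intro equalityI subsetI)
    fix g assume "g \<in> a <# U"
    then show "g \<in> {g \<in> topspace T. inv a \<otimes> g \<in> U}"
      using assms(1) U by (auto simp: l_coset_def topspace_eq simp flip: m_assoc)
  next
    fix g assume g: "g \<in> {g \<in> topspace T. inv a \<otimes> g \<in> U}"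
    then have "g = a \<otimes> (inv a \<otimes> g)"
      using assms(1) by (simp add: topspace_eq flip: m_assoc)
    then show "g \<in> a <# U" using g unfolding l_coset_def by blast
  qed
  then show ?thesis
    using openin_continuous_map_preimage[OF continuous_map_left_translation assms(2)] assms(1)
    by simp
qed

lemma openin_lcosets:
  assumes "openin T H" "x \<in> lcosets H"
  shows "openin T x"
  using assms openin_l_coset by (auto elim: lcosetsE)

text \<open>Writing \<open>x = aH\<close>, the coset \<open>gx\<close> is the one that contains \<open>g a\<close>. The set in question is
  therefore the preimage, under right translation by \<open>a\<close>, of a union of open cosets. For
  \<open>x = H\<close> this yields discreteness of the coset space, and for general \<open>x\<close> continuity of the
  action.\<close>

lemma openin_coset_preimage:
  assumes H: "subgroup H G" "openin T H" and x: "x \<in> lcosets H" and U: "U \<subseteq> lcosets H"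
  shows "openin T {g \<in> topspace T. g <# x \<in> U}"
proof -
  obtain a where a: "a \<in> carrier G" "x = a <# H" using x by (rule lcosetsE)
  have "g <# x \<in> U \<longleftrightarrow> g \<otimes> a \<in> \<Union>U" if g: "g \<in> carrier G" for g
  proof -
    have gx: "g <# x = (g \<otimes> a) <# H"
      using a g H by (simp add: lcos_m_assoc subgroup.subset)
    have self: "g \<otimes> a \<in> g <# x"
      unfolding gx using a g H by (simp add: lcos_self)
    have "c = g <# x" if "c \<in> U" "g \<otimes> a \<in> c" for c
      using lcos_disjoint[OF H(1)] that U self l_coset_in_lcosets[OF H(1) g x] by blast
    with self show ?thesis by blast
  qed
  then have "{g \<in> topspace T. g <# x \<in> U} = {g \<in> topspace T. g \<otimes> a \<in> \<Union>U}"
    by (auto simp: topspace_eq)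
  moreover have "openin T (\<Union>U)" using openin_lcosets[OF H(2)] U by blast
  ultimately show ?thesis
    using openin_continuous_map_preimage[OF continuous_map_right_translation[OF a(1)]] by metis
qed

lemma coset_topology_discrete:
  assumes H: "subgroup H G" "openin T H"
  shows "coset_topology G T H = discrete_topology (lcosets H)"
proof -
  show ?thesis
    by (auto simp: topology_eq openin_coset_topology
        openin_coset_preimage[OF H subgroup_in_lcosets[OF H(1)]])
qed

lemma countable_lcosets:
  assumes "second_countable T" and H: "subgroup H G" "openin T H"
  shows "countable (lcosets H)"
proof -
  have "second_countable (discrete_topology (lcosets H))"
  proof (rule second_countable_open_map_image[of T _ "\<lambda>g. g <# H"])
    show "continuous_map T (discrete_topology (lcosets H)) (\<lambda>g. g <# H)"
      using openin_coset_preimage[OF H subgroup_in_lcosets[OF H(1)]]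
      by (auto simp: continuous_map_def topspace_eq in_lcosets)
    show "open_map T (discrete_topology (lcosets H)) (\<lambda>g. g <# H)"
      by (auto simp: open_map_def in_lcosets topspace_eq dest!: openin_subset)
    show "(\<lambda>g. g <# H) ` topspace T = topspace (discrete_topology (lcosets H))"
      by (auto simp: topspace_eq LCOSETS_def)
  qed (rule assms)
  then show ?thesis by (simp add: second_countable_discrete_topology)
qed

lemma continuous_coset_action:
  assumes H: "subgroup H G" "openin T H"
  shows "continuous_map (prod_topology T (discrete_topology (lcosets H)))
     (discrete_topology (lcosets H)) (\<lambda>(g, x). coset_action G H g x)"
  unfolding continuous_map_def
proof (intro conjI allI impI)
  show "(\<lambda>(g, x). coset_action G H g x)
      \<in> topspace (prod_topology T (discrete_topology (lcosets H))) \<rightarrow>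
        topspace (discrete_topology (lcosets H))"
    using H by (auto simp: topspace_eq l_coset_in_lcosets)
  fix U assume "openin (discrete_topology (lcosets H)) U"
  then have U: "U \<subseteq> lcosets H" by simp
  have "{p \<in> topspace (prod_topology T (discrete_topology (lcosets H))).
      (case p of (g, x) \<Rightarrow> coset_action G H g x) \<in> U} =
      (\<Union>x \<in> lcosets H. {g \<in> topspace T. g <# x \<in> U} \<times> {x})"
    by auto
  also have "openin (prod_topology T (discrete_topology (lcosets H))) \<dots>"
    using openin_coset_preimage[OF H _ U]
    by (intro openin_Union) (auto simp: openin_prod_Times_iff)
  finally show "openin (prod_topology T (discrete_topology (lcosets H)))
      {p \<in> topspace (prod_topology T (discrete_topology (lcosets H))).
        (case p of (g, x) \<Rightarrow> coset_action G H g x) \<in> U}" .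
qed

theorem proper_coset_metric_imp_stabilizer:
  assumes H: "subgroup H G" "openin T H"
    and d: "Metric_space (lcosets H) d"
      "Metric_space.mtopology (lcosets H) d = coset_topology G T H"
      "proper_metric (lcosets H) d" "invariant_coset_metric G H d"
  shows "stabilizer_in_locally_finite_space TYPE('a set) G T H"
proof -
  have disc: "Metric_space.mtopology (lcosets H) d = discrete_topology (lcosets H)"
    using d(2) coset_topology_discrete[OF H] by simp
  have "continuous_isometric_action G T (lcosets H) d (coset_action G H)"
    using d(4) H coset_action_is_group_action continuous_coset_action
    by (simp add: continuous_isometric_action_def invariant_coset_metric_def disc)
  moreover have "H \<in> lcosets H" using H(1) by (rule subgroup_in_lcosets)
  moreover have "stabilizer G (coset_action G H) H = H"
    using stabilizer_coset_action[OF H(1) one_closed] subgroup.subset[OF H(1)]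
    by (auto simp: lcos_mult_one)
  ultimately show ?thesis
    unfolding stabilizer_in_locally_finite_space_def locally_finite_metric_def
    using d disc by blast
qed

text \<open>The type of the metric space is arbitrary, so the same result serves both versions of the
  stabilizer condition.\<close>

theorem stabilizer_imp_open_almost_normal:
  assumes "stabilizer_in_locally_finite_space TYPE('m) G T H"
  shows "openin T H \<and> almost_normal G H"
proof -
  obtain M :: "'m set" and d \<phi> x where
    M: "Metric_space M d" "locally_finite_metric M d"
      "continuous_isometric_action G T M d \<phi>" and x: "x \<in> M" "stabilizer G \<phi> x = H"
    using assms unfolding stabilizer_in_locally_finite_space_def by blast
  interpret Metric_space M d by (rule M)
  interpret group_action G M \<phi>
    using M(3) by (simp add: continuous_isometric_action_def)
  have disc: "mtopology = discrete_topology M"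
    using M(2) by (simp add: locally_finite_metric_def)
  have "continuous_map T (prod_topology T mtopology) (\<lambda>g. (g, x))"
    using x by (simp add: continuous_map_pairwise o_def)
  then have "continuous_map T mtopology (\<lambda>g. \<phi> g x)"
    using continuous_map_compose M(3)
    unfolding continuous_isometric_action_def by (fastforce simp: o_def)
  moreover have "openin mtopology {x}" using x by (simp add: disc)
  ultimately have "openin T {g \<in> topspace T. \<phi> g x \<in> {x}}"
    by (rule openin_continuous_map_preimage)
  moreover have "{g \<in> topspace T. \<phi> g x \<in> {x}} = H"
    using x(2) by (auto simp: stabilizer_def topspace_eq)
  ultimately have "openin T H" by simp
  moreover have "finite ((\<lambda>h. \<phi> h y) ` stabilizer G \<phi> x)" if y: "y \<in> M" for y
  proof (rule finite_subset)
    show "(\<lambda>h. \<phi> h y) ` stabilizer G \<phi> x \<subseteq> mcball x (d x y)"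
    proof clarify
      fix h assume "h \<in> stabilizer G \<phi> x"
      then have h: "h \<in> carrier G" "\<phi> h x = x" by (auto simp: stabilizer_def)
      \<comment> \<open>As \<open>h\<close> fixes \<open>x\<close>, this compares \<open>d (\<phi> h x) (\<phi> h y)\<close> with \<open>d x y\<close>.\<close>
      then have "d x (\<phi> h y) = d x y"
        using M(3) x(1) y unfolding continuous_isometric_action_def by metis
      then show "\<phi> h y \<in> mcball x (d x y)"
        using x(1) y h(1) element_image by simp
    qed
    show "finite (mcball x (d x y))"
      using M(2) x(1)
      by (simp add: locally_finite_metric_def proper_metric_def disc compactin_discrete_topology)
  qed
  ultimately show ?thesis using almost_normal_stabilizer[OF x(1)] x(2) by simp
qed

text \<open>A locally finite metric is discrete and so compatible with the coset topology, which is
  discrete as well.\<close>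

theorem open_almost_normal_imp_proper_coset_metric:
  assumes "second_countable T" and H: "subgroup H G" "openin T H"
    and an: "almost_normal G H"
  shows "\<exists>d. Metric_space (lcosets H) d \<and>
    Metric_space.mtopology (lcosets H) d = coset_topology G T H \<and>
    proper_metric (lcosets H) d \<and> invariant_coset_metric G H d"
proof -
  interpret group_action G "lcosets H" "coset_action G H"
    using H(1) by (rule coset_action_is_group_action)
  obtain d where "Metric_space (lcosets H) d" "locally_finite_metric (lcosets H) d"
    "\<And>g x y. g \<in> carrier G \<Longrightarrow> x \<in> lcosets H \<Longrightarrow> y \<in> lcosets H \<Longrightarrow>
       d (coset_action G H g x) (coset_action G H g y) = d x y"
    using invariant_locally_finite_metric[OF countable_lcosets[OF assms(1) H]
        almost_normal_finite_stabilizer_orbits[OF H(1) an]] by blast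
  then show ?thesis
    by (auto simp: locally_finite_metric_def invariant_coset_metric_def coset_topology_discrete[OF H])
qed

end


section \<open>The equivalence\<close>

theorem theorem2p15:
  fixes G :: "('a, 'c) monoid_scheme" and T :: "'a topology" and H :: "'a set"
  assumes "topological_group G T"
    and "second_countable T"
    and "locally_compact_space T"
    and "subgroup H G"
    and "closedin T H"
  defines "i \<equiv> openin T H \<and>
      (\<exists>d. Metric_space (lcosets\<^bsub>G\<^esub> H) d \<and>
        Metric_space.mtopology (lcosets\<^bsub>G\<^esub> H) d = coset_topology G T H \<and>
        proper_metric (lcosets\<^bsub>G\<^esub> H) d \<and>
        invariant_coset_metric G H d)"
    and "ii \<equiv> stabilizer_in_locally_finite_space TYPE('a set) G T H"
    and "ii_any_type \<equiv> stabilizer_in_locally_finite_space TYPE('m) G T H"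
    and "iii \<equiv> openin T H \<and> almost_normal G H"
  shows "(i \<longleftrightarrow> ii) \<and> (ii \<longleftrightarrow> iii) \<and> (ii_any_type \<longrightarrow> ii)"
proof -
  interpret topological_group G T by (rule assms)
  have "i \<Longrightarrow> ii"
    unfolding i_def ii_def using proper_coset_metric_imp_stabilizer[OF assms(4)] by blast
  moreover have "ii \<Longrightarrow> iii" "ii_any_type \<Longrightarrow> iii"
    unfolding ii_def ii_any_type_def iii_def by (fact stabilizer_imp_open_almost_normal)+
  moreover have "iii \<Longrightarrow> i"
    unfolding i_def iii_def
    using open_almost_normal_imp_proper_coset_metric[OF assms(2,4)] by blast
  ultimately show ?thesis by blast
qed

end
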